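(* Let $\mathcal{I}$ be a maximal ideal on $\mathbf{N}$. Then $\mathcal{I}$-statistical convergence does not coincide with statistical convergence.
   Context: $\mathbf{N}$ denotes the positive integers. An ideal on $\mathbf{N}$ is a family $\mathcal{I}\subseteq\mathcal{P}(\mathbf{N})$ closed under finite unions and subsets, containing all finite subsets of $\mathbf{N}$, and different from $\mathcal{P}(\mathbf{N})$. It is maximal if it is maximal with respect to inclusion among such ideals (equivalently, for each $A\subseteq\mathbf{N}$ exactly one of $A$, $\mathbf{N}\setminus A$ belongs to $\mathcal{I}$). Let $\mathcal{Z}=\{A\subseteq\mathbf{N}:\lim_{n\to\infty}|A\cap[1,n]|/n=0\}$. A sequence $(x_n)$ in a Hausdorff space $X$ is statistically convergent to $\ell\in X$ if $\{n\in\mathbf{N}:x_n\notin U\}\in\mathcal{Z}$ for all neighborhoods $U$ of $\ell$. It is $\mathcal{I}$-statistically convergent to $\ell$ if $$\left\{n\in\mathbf{N}:\frac{|\{k\in[1,n]:x_k\notin U\}|}{n}\ge\varepsilon\right\}\in\mathcal{I}$$ for all neighborhoods $U$ of $\ell$ and all $\varepsilon>0$. The two notions coincide if, for some Hausdorff space $X$ with at least two points, every sequence $(x_n)$ in $X$ is $\mathcal{I}$-statistically convergent to $\ell\in X$ if and only if it is statistically convergent to $\ell$. *)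

theory Defs
  imports "HOL-Analysis.Analysis"
begin

abbreviation pos_nats :: "nat set" where
  "pos_nats \<equiv> {1..}"

definition ideal_on_pos_nats :: "nat set set \<Rightarrow> bool" where
  "ideal_on_pos_nats I \<longleftrightarrow>
     I \<subseteq> Pow pos_nats \<and>
     (\<forall>A\<in>I. \<forall>B\<in>I. A \<union> B \<in> I) \<and>
     (\<forall>A\<in>I. \<forall>B. B \<subseteq> A \<longrightarrow> B \<in> I) \<and>
     (\<forall>A. A \<subseteq> pos_nats \<and> finite A \<longrightarrow> A \<in> I) \<and>
     I \<noteq> Pow pos_nats"

definition maximal_ideal_on_pos_nats :: "nat set set \<Rightarrow> bool" where
  "maximal_ideal_on_pos_nats I \<longleftrightarrow>
     ideal_on_pos_nats I \<and> (\<forall>J. ideal_on_pos_nats J \<and> I \<subseteq> J \<longrightarrow> J = I)"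

definition density_zero_ideal :: "nat set set" where
  "density_zero_ideal =
     {A. A \<subseteq> pos_nats \<and> (\<lambda>n. real (card (A \<inter> {1..n})) / real n) \<longlonglongrightarrow> 0}"

definition neighbourhood_in :: "'a topology \<Rightarrow> 'a \<Rightarrow> 'a set \<Rightarrow> bool" where
  "neighbourhood_in X l U \<longleftrightarrow> U \<subseteq> topspace X \<and> (\<exists>V. openin X V \<and> l \<in> V \<and> V \<subseteq> U)"

text \<open>Sequences are indexed by the positive integers: the value at \<open>0\<close> is never used.\<close>

definition stat_convergent :: "'a topology \<Rightarrow> (nat \<Rightarrow> 'a) \<Rightarrow> 'a \<Rightarrow> bool" where
  "stat_convergent X x l \<longleftrightarrow>
     (\<forall>U. neighbourhood_in X l U \<longrightarrow> {n \<in> pos_nats. x n \<notin> U} \<in> density_zero_ideal)"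

definition ideal_stat_convergent ::
    "nat set set \<Rightarrow> 'a topology \<Rightarrow> (nat \<Rightarrow> 'a) \<Rightarrow> 'a \<Rightarrow> bool" where
  "ideal_stat_convergent I X x l \<longleftrightarrow>
     (\<forall>U. \<forall>\<epsilon>::real. neighbourhood_in X l U \<and> \<epsilon> > 0 \<longrightarrow>
        {n \<in> pos_nats. real (card {k \<in> {1..n}. x k \<notin> U}) / real n \<ge> \<epsilon>} \<in> I)"

definition stat_convergences_agree_in :: "nat set set \<Rightarrow> 'a topology \<Rightarrow> bool" where
  "stat_convergences_agree_in I X \<longleftrightarrow>
     (\<forall>x l. (\<forall>n\<in>pos_nats. x n \<in> topspace X) \<and> l \<in> topspace X \<longrightarrow>
        (ideal_stat_convergent I X x l \<longleftrightarrow> stat_convergent X x l))"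

end

theory Submission imports Defs begin

text \<open>
  Cut the integers into the blocks from \<open>j!\<close> to \<open>(j + 1)!\<close> and group them by \<open>j\<close> modulo 3. A maximal
  ideal is prime, so the complement of one of the three groups, say the one of residue \<open>r\<close>, belongs
  to it. Let \<open>A\<close> be the group of residue \<open>r + 1\<close>. Its density up to \<open>n\<close> is near 1 at the end of each
  of its blocks; the following block of residue \<open>r + 2\<close> dilutes it, so it tends to 0 as \<open>n\<close> runs
  through the blocks of residue \<open>r\<close>. Taking a point \<open>b\<close> on \<open>A\<close> and a point \<open>a \<noteq> b\<close> elsewhere gives a
  sequence that converges to \<open>a\<close> ideal-statistically but not statistically.
\<close>

lemma ideal_subset:
  assumes "ideal_on_pos_nats I" "A \<in> I" "B \<subseteq> A"
  shows "B \<in> I"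
  using assms unfolding ideal_on_pos_nats_def by blast

lemma ideal_Un:
  assumes "ideal_on_pos_nats I" "A \<in> I" "B \<in> I"
  shows "A \<union> B \<in> I"
  using assms unfolding ideal_on_pos_nats_def by blast

lemma ideal_finite:
  assumes "ideal_on_pos_nats I" "A \<subseteq> pos_nats" "finite A"
  shows "A \<in> I"
  using assms unfolding ideal_on_pos_nats_def by blast

lemma ideal_pos_nats_notin:
  assumes "ideal_on_pos_nats I"
  shows "pos_nats \<notin> I"
proof
  assume "pos_nats \<in> I"
  then have "Pow pos_nats \<subseteq> I"
    using ideal_subset[OF assms] by blast
  then show False
    using assms unfolding ideal_on_pos_nats_def by blast
qed

text \<open>Primeness, by adjoining \<open>A\<close>: the sets whose part outside \<open>A\<close>
  lies in \<open>I\<close> form a family \<open>J\<close> that contains both \<open>I\<close> and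
  \<open>A\<close>. By maximality \<open>J\<close> is not an ideal, yet it can only fail to be one
  by being the full power set, and \<open>pos_nats\<close> in \<open>J\<close> is the claim.\<close>

lemma maximal_ideal_compl_in:
  assumes max: "maximal_ideal_on_pos_nats I" and A: "A \<subseteq> pos_nats" "A \<notin> I"
  shows "pos_nats - A \<in> I"
proof -
  have id: "ideal_on_pos_nats I"
    using max unfolding maximal_ideal_on_pos_nats_def by blast
  define J where "J = {B. B \<subseteq> pos_nats \<and> B - A \<in> I}"
  have "I \<subseteq> J"
    using id unfolding J_def ideal_on_pos_nats_def by blast
  have "{} \<in> I"
    by (rule ideal_finite[OF id]) auto
  then have "A \<in> J"
    using A(1) unfolding J_def by simp
  then have "J \<noteq> I"
    using A(2) by blast
  then have "\<not> ideal_on_pos_nats J"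
    using max \<open>I \<subseteq> J\<close> unfolding maximal_ideal_on_pos_nats_def by blast
  moreover have "B \<union> C \<in> J" if "B \<in> J" "C \<in> J" for B C
    using ideal_Un[OF id, of "B - A" "C - A"] that unfolding J_def by (simp add: Un_Diff)
  moreover have "C \<in> J" if "B \<in> J" "C \<subseteq> B" for B C
  proof -
    have "C - A \<in> I"
      using that unfolding J_def by (auto intro: ideal_subset[OF id, of "B - A"])
    then show ?thesis
      using that unfolding J_def by auto
  qed
  moreover have "B \<in> J" if "B \<subseteq> pos_nats" "finite B" for B
    using ideal_finite[OF id that] \<open>I \<subseteq> J\<close> by blast
  moreover have "J \<subseteq> Pow pos_nats"
    unfolding J_def by blast
  ultimately have "J = Pow pos_nats"
    unfolding ideal_on_pos_nats_def by blast
  then show ?thesis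
    unfolding J_def by blast
qed

text \<open>Half-open blocks are pairwise disjoint and cover every integer above 1. The block of
  \<open>j = 0\<close> is empty since 0! = 1!, and 1 lies in no block.\<close>

definition factorial_blocks :: "nat \<Rightarrow> nat set" where
  "factorial_blocks r = (\<Union>j\<in>{j. j mod 3 = r}. {fact j<..fact (Suc j)})"

lemma factorial_blocks_subset: "factorial_blocks r \<subseteq> pos_nats"
  unfolding factorial_blocks_def by auto

lemma factorial_block_exists:
  fixes n :: nat
  assumes "n \<ge> 2"
  obtains j where "fact j < n" "n \<le> fact (Suc j)"
proof -
  define j where "j = (LEAST j. n \<le> fact (Suc j))"
  have "n \<le> fact (Suc n)"
    using fact_ge_self[of "Suc n"] by simp
  then have j: "n \<le> fact (Suc j)"
    unfolding j_def by (rule LeastI)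
  have "fact j < n"
  proof (cases j)
    \<comment> \<open>Minimality of \<open>j\<close> gives nothing here; the bound 0! = 1 <
      \<open>n\<close> is the hypothesis on \<open>n\<close>.\<close>
    case 0
    then show ?thesis using assms by simp
  next
    case (Suc i)
    then have "\<not> n \<le> fact (Suc i)"
      using not_less_Least[of i "\<lambda>j. n \<le> fact (Suc j)"] unfolding j_def by simp
    then show ?thesis using Suc by simp
  qed
  with j show thesis using that by blast
qed

lemma pos_nats_eq_factorial_blocks:
  "pos_nats = {1} \<union> (factorial_blocks 0 \<union> (factorial_blocks 1 \<union> factorial_blocks 2))"
proof
  show "pos_nats \<subseteq> {1} \<union> (factorial_blocks 0 \<union> (factorial_blocks 1 \<union> factorial_blocks 2))"
  proof
    fix n :: nat assume n: "n \<in> pos_nats"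
    show "n \<in> {1} \<union> (factorial_blocks 0 \<union> (factorial_blocks 1 \<union> factorial_blocks 2))"
    proof (cases "n = 1")
      case False
      with n have "n \<ge> 2" by simp
      then obtain j where j: "fact j < n" "n \<le> fact (Suc j)"
        by (rule factorial_block_exists)
      then have "n \<in> factorial_blocks (j mod 3)"
        unfolding factorial_blocks_def by auto
      moreover have "j mod 3 = 0 \<or> j mod 3 = 1 \<or> j mod 3 = 2" by linarith
      ultimately show ?thesis by auto
    qed simp
  qed
  show "{1} \<union> (factorial_blocks 0 \<union> (factorial_blocks 1 \<union> factorial_blocks 2)) \<subseteq> pos_nats"
    using factorial_blocks_subset by simp
qed

text \<open>Otherwise the three groups and the finite set \<open>{1}\<close> would put their union
  \<open>pos_nats\<close> into \<open>I\<close>.\<close>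

lemma ideal_factorial_blocks_notin:
  assumes "ideal_on_pos_nats I"
  obtains r where "r < 3" "factorial_blocks r \<notin> I"
proof -
  have "{1} \<in> I"
    by (rule ideal_finite[OF assms]) auto
  then have "factorial_blocks 0 \<notin> I \<or> factorial_blocks 1 \<notin> I \<or> factorial_blocks 2 \<notin> I"
    using ideal_pos_nats_notin[OF assms] ideal_Un[OF assms] pos_nats_eq_factorial_blocks by metis
  then show thesis
    using that[of 0] that[of 1] that[of 2] by auto
qed

text \<open>The latest block of residue j + 1 that starts before \<open>n\<close> has index at most
  j - 2, so it ends by (j - 1)!, and (j - 1)! = j! / j < n / j.\<close>

lemma factorial_blocks_diluted:
  assumes n: "fact j < n" "n \<le> fact (Suc j)"
  shows "real (card (factorial_blocks (Suc j mod 3) \<inter> {1..n})) / real n \<le> 1 / real j"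
proof (cases j)
  \<comment> \<open>Vacuous: no \<open>n\<close> satisfies 0! < \<open>n\<close> \<le> 1!.\<close>
  case 0
  then show ?thesis using n by simp
next
  case (Suc i)
  have "factorial_blocks (Suc j mod 3) \<inter> {1..n} \<subseteq> {1..fact i}"
  proof
    fix m assume "m \<in> factorial_blocks (Suc j mod 3) \<inter> {1..n}"
    then obtain k where k: "k mod 3 = Suc j mod 3" "fact k < m" "m \<le> fact (Suc k)"
      and m: "1 \<le> m" "m \<le> n"
      unfolding factorial_blocks_def by auto
    have "fact k < (fact (Suc j) :: nat)"
      using k m n by linarith
    then have "k < Suc j"
      using fact_mono_nat[of "Suc j" k] by linarith
    \<comment> \<open>Being congruent to j + 1 modulo 3 and smaller, \<open>k\<close> is at most j -
      2 = i - 1.\<close>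
    then have "Suc k \<le> i"
      using k(1) Suc by presburger
    then have "m \<le> fact i"
      using k(3) fact_mono_nat[of "Suc k" i] by linarith
    then show "m \<in> {1..fact i}" using m by simp
  qed
  then have "card (factorial_blocks (Suc j mod 3) \<inter> {1..n}) \<le> card {1..fact i :: nat}"
    by (intro card_mono) auto
  then have "j * card (factorial_blocks (Suc j mod 3) \<inter> {1..n}) \<le> j * fact i"
    by simp
  also have "\<dots> = fact j" using Suc by simp
  also have "\<dots> < n" by (rule n)
  finally have "real j * real (card (factorial_blocks (Suc j mod 3) \<inter> {1..n})) \<le> real n"
    unfolding of_nat_mult[symmetric] of_nat_le_iff by linarith
  moreover have "real j > 0" "real n > 0"
    using Suc n by auto
  ultimately show ?thesis
    by (simp add: field_simps)
qed

text \<open>If \<open>n\<close> lies in block \<open>j\<close>, dilution gives \<epsilon> \<le> 1/j.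
  This bounds \<open>j\<close>, and with it \<open>n\<close> \<le> (j + 1)!.\<close>

lemma finite_dense_times_factorial_blocks:
  assumes "\<epsilon> > 0"
  shows "finite {n \<in> factorial_blocks r.
    \<epsilon> \<le> real (card (factorial_blocks (Suc r mod 3) \<inter> {1..n})) / real n}"
proof (rule finite_subset)
  show "{n \<in> factorial_blocks r.
      \<epsilon> \<le> real (card (factorial_blocks (Suc r mod 3) \<inter> {1..n})) / real n}
    \<subseteq> {..fact (Suc (nat \<lfloor>1 / \<epsilon>\<rfloor>))}"
  proof
    fix n assume "n \<in> {n \<in> factorial_blocks r.
      \<epsilon> \<le> real (card (factorial_blocks (Suc r mod 3) \<inter> {1..n})) / real n}"
    then obtain j where j: "j mod 3 = r" "fact j < n" "n \<le> fact (Suc j)"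
      and e: "\<epsilon> \<le> real (card (factorial_blocks (Suc r mod 3) \<inter> {1..n})) / real n"
      unfolding factorial_blocks_def by auto
    have "Suc r mod 3 = Suc j mod 3"
      using j(1) by (simp add: mod_Suc_eq flip: j(1))
    then have "\<epsilon> \<le> 1 / real j"
      using e factorial_blocks_diluted[OF j(2,3)] by simp
    then have "real j \<le> 1 / \<epsilon>"
      using assms by (cases "j = 0") (auto simp: field_simps)
    then have "j \<le> nat \<lfloor>1 / \<epsilon>\<rfloor>"
      by (simp add: le_nat_floor)
    then have "(fact (Suc j) :: nat) \<le> fact (Suc (nat \<lfloor>1 / \<epsilon>\<rfloor>))"
      by (intro fact_mono_nat) simp
    then show "n \<in> {..fact (Suc (nat \<lfloor>1 / \<epsilon>\<rfloor>))}"
      using j(3) by (simp only: atMost_iff)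
  qed
qed simp

text \<open>Block \<open>j\<close> alone has (j + 1)! - j! = j * j! elements, a fraction j / (j + 1)
  of (j + 1)!.\<close>

lemma factorial_blocks_dense:
  assumes "j mod 3 = r" "j \<ge> 1"
  shows "1 / 2 \<le> real (card (factorial_blocks r \<inter> {1..fact (Suc j)})) / real (fact (Suc j))"
proof -
  have "card {fact j<..fact (Suc j) :: nat} \<le> card (factorial_blocks r \<inter> {1..fact (Suc j)})"
    using assms(1) by (intro card_mono) (auto simp: factorial_blocks_def)
  moreover have "card {fact j<..fact (Suc j) :: nat} = j * fact j"
    by simp
  moreover have "fact (Suc j) \<le> 2 * (j * fact j :: nat)"
    using assms(2) by simp
  ultimately have "fact (Suc j) \<le> 2 * card (factorial_blocks r \<inter> {1..fact (Suc j)})"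
    by linarith
  then have "real (fact (Suc j)) \<le> 2 * real (card (factorial_blocks r \<inter> {1..fact (Suc j)}))"
    by (metis of_nat_le_iff of_nat_mult of_nat_numeral)
  moreover have "real (fact (Suc j)) > 0"
    by (simp only: of_nat_0_less_iff fact_gt_zero)
  ultimately show ?thesis
    by (simp only: pos_le_divide_eq)
qed

lemma factorial_blocks_notin_density_zero:
  assumes "r < 3"
  shows "factorial_blocks r \<notin> density_zero_ideal"
proof
  assume "factorial_blocks r \<in> density_zero_ideal"
  then have "(\<lambda>n. real (card (factorial_blocks r \<inter> {1..n})) / real n) \<longlonglongrightarrow> 0"
    unfolding density_zero_ideal_def by simp
  then have "\<forall>\<^sub>F n in sequentially. real (card (factorial_blocks r \<inter> {1..n})) / real n < 1 / 2"
    by (rule order_tendstoD) simp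
  then obtain N where N:
    "\<And>n. n \<ge> N \<Longrightarrow> real (card (factorial_blocks r \<inter> {1..n})) / real n < 1 / 2"
    unfolding eventually_sequentially by blast
  \<comment> \<open>An index of residue \<open>r\<close> beyond \<open>N\<close>;
    \<open>Suc N\<close> keeps it positive even if \<open>N\<close> and \<open>r\<close> are
    0.\<close>
  define j where "j = 3 * Suc N + r"
  have "N \<le> Suc j" unfolding j_def by simp
  also have "\<dots> \<le> fact (Suc j)" by (rule fact_ge_self)
  finally have "real (card (factorial_blocks r \<inter> {1..fact (Suc j)})) / real (fact (Suc j)) < 1 / 2"
    by (rule N)
  moreover have "j mod 3 = r" "j \<ge> 1"
    using assms unfolding j_def by presburger+
  ultimately show False
    using factorial_blocks_dense by fastforce
qed

text \<open>Times outside the blocks of residue \<open>r\<close> form a member of \<open>I\<close>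
  by primeness; inside them only finitely many are dense for \<open>A\<close>.\<close>

lemma maximal_ideal_sparse_along:
  assumes max: "maximal_ideal_on_pos_nats I"
  obtains A where "A \<subseteq> pos_nats" "A \<notin> density_zero_ideal"
    "\<And>\<epsilon>. \<epsilon> > 0 \<Longrightarrow> {n \<in> pos_nats. \<epsilon> \<le> real (card (A \<inter> {1..n})) / real n} \<in> I"
proof -
  have id: "ideal_on_pos_nats I"
    using max unfolding maximal_ideal_on_pos_nats_def by blast
  obtain r where r: "r < 3" "factorial_blocks r \<notin> I"
    by (rule ideal_factorial_blocks_notin[OF id])
  define A where "A = factorial_blocks (Suc r mod 3)"
  have "{n \<in> pos_nats. \<epsilon> \<le> real (card (A \<inter> {1..n})) / real n} \<in> I" if "\<epsilon> > 0" for \<epsilon>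
  proof (rule ideal_subset[OF id])
    have "pos_nats - factorial_blocks r \<in> I"
      by (rule maximal_ideal_compl_in[OF max factorial_blocks_subset r(2)])
    moreover have "{n \<in> factorial_blocks r. \<epsilon> \<le> real (card (A \<inter> {1..n})) / real n} \<in> I"
      unfolding A_def using finite_dense_times_factorial_blocks[OF that] factorial_blocks_subset
      by (intro ideal_finite[OF id]) auto
    ultimately show "(pos_nats - factorial_blocks r) \<union>
        {n \<in> factorial_blocks r. \<epsilon> \<le> real (card (A \<inter> {1..n})) / real n} \<in> I"
      by (rule ideal_Un[OF id])
  qed auto
  moreover have "A \<notin> density_zero_ideal"
    unfolding A_def by (rule factorial_blocks_notin_density_zero) simp
  moreover have "A \<subseteq> pos_nats"
    unfolding A_def by (rule factorial_blocks_subset)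
  ultimately show thesis
    using that by blast
qed

theorem theorem2p10:
  fixes I :: "nat set set"
  assumes "maximal_ideal_on_pos_nats I"
  shows "\<not> (\<exists>X :: 'a topology.
             Hausdorff_space X \<and>
             (\<exists>a\<in>topspace X. \<exists>b\<in>topspace X. a \<noteq> b) \<and>
             stat_convergences_agree_in I X)"
proof
  assume "\<exists>X :: 'a topology.
             Hausdorff_space X \<and>
             (\<exists>a\<in>topspace X. \<exists>b\<in>topspace X. a \<noteq> b) \<and>
             stat_convergences_agree_in I X"
  then obtain X :: "'a topology" and a b where X: "Hausdorff_space X"
    and ab: "a \<in> topspace X" "b \<in> topspace X" "a \<noteq> b"
    and agree: "stat_convergences_agree_in I X"
    by blast
  obtain A where A: "A \<subseteq> pos_nats" "A \<notin> density_zero_ideal"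
    and A_I: "\<And>\<epsilon>. \<epsilon> > 0 \<Longrightarrow> {n \<in> pos_nats. \<epsilon> \<le> real (card (A \<inter> {1..n})) / real n} \<in> I"
    by (rule maximal_ideal_sparse_along[OF assms]) blast
  have id: "ideal_on_pos_nats I"
    using assms unfolding maximal_ideal_on_pos_nats_def by blast
  define x where "x n = (if n \<in> A then b else a)" for n
  \<comment> \<open>Separation yields a neighbourhood \<open>U\<close> of \<open>a\<close> that
    misses \<open>b\<close>, so the indices with \<open>x n\<close> outside \<open>U\<close> are
    exactly those in \<open>A\<close>.\<close>
  obtain U V where UV: "openin X U" "openin X V" "a \<in> U" "b \<in> V" "disjnt U V"
    using X ab unfolding Hausdorff_space_def by blast
  have "b \<notin> U"
    using UV unfolding disjnt_def by blast
  then have "{n \<in> pos_nats. x n \<notin> U} = A"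
    using UV A(1) unfolding x_def by auto
  moreover have "neighbourhood_in X a U"
    using UV openin_subset unfolding neighbourhood_in_def by blast
  ultimately have "\<not> stat_convergent X x a"
    using A(2) unfolding stat_convergent_def by metis
  moreover have "ideal_stat_convergent I X x a"
    unfolding ideal_stat_convergent_def
  proof (intro allI impI)
    fix W and \<epsilon> :: real
    assume W: "neighbourhood_in X a W \<and> \<epsilon> > 0"
    then have "a \<in> W" unfolding neighbourhood_in_def by blast
    \<comment> \<open>Only an inequality, since an arbitrary neighbourhood \<open>W\<close> of
      \<open>a\<close> may contain \<open>b\<close> too.\<close>
    have "real (card {k \<in> {1..n}. x k \<notin> W}) / real n \<le> real (card (A \<inter> {1..n})) / real n" for n
      using \<open>a \<in> W\<close> by (intro divide_right_mono of_nat_mono card_mono) (auto simp: x_def)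
    then have "{n \<in> pos_nats. \<epsilon> \<le> real (card {k \<in> {1..n}. x k \<notin> W}) / real n}
        \<subseteq> {n \<in> pos_nats. \<epsilon> \<le> real (card (A \<inter> {1..n})) / real n}"
      using order_trans by blast
    then show "{n \<in> pos_nats. \<epsilon> \<le> real (card {k \<in> {1..n}. x k \<notin> W}) / real n} \<in> I"
      using ideal_subset[OF id A_I] W by blast
  qed
  moreover have "\<forall>n\<in>pos_nats. x n \<in> topspace X"
    using ab unfolding x_def by simp
  ultimately show False
    using agree ab(1) unfolding stat_convergences_agree_in_def by blast
qed

end
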